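(* If $G$ is a finite simple graph of order $n$ with at least one edge, then $1\le es_{\chi'}(G) \leq \lfloor \frac{n}{2} \rfloor$.
   Context: All graphs are finite, simple and have at least one edge. $\chi'(G)$ is the chromatic index of $G$. The chromatic edge stability index $es_{\chi'}(G)$ is the minimum cardinality of a set of edges $F\subseteq E(G)$ such that $\chi'(G\setminus F)<\chi'(G)$, where $G\setminus F$ is $G$ with the edges of $F$ deleted (all vertices are kept; an edgeless graph has chromatic index $0$). *)

theory Defs
  imports Main
begin

record 'a graph =
  verts :: "'a set"
  edges :: "'a set set"

definition simple_graph :: "'a graph \<Rightarrow> bool" where
  "simple_graph G \<longleftrightarrow>
     finite (verts G) \<and> (\<forall>e\<in>edges G. e \<subseteq> verts G \<and> card e = 2)"

definition delete_edges :: "'a graph \<Rightarrow> 'a set set \<Rightarrow> 'a graph" where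
  "delete_edges G F = G\<lparr>edges := edges G - F\<rparr>"

definition proper_edge_coloring :: "'a graph \<Rightarrow> ('a set \<Rightarrow> nat) \<Rightarrow> bool" where
  "proper_edge_coloring G c \<longleftrightarrow>
     (\<forall>e\<in>edges G. \<forall>f\<in>edges G. e \<noteq> f \<and> e \<inter> f \<noteq> {} \<longrightarrow> c e \<noteq> c f)"

definition edge_colorable :: "'a graph \<Rightarrow> nat \<Rightarrow> bool" where
  "edge_colorable G k \<longleftrightarrow>
     (\<exists>c. proper_edge_coloring G c \<and> c ` edges G \<subseteq> {..<k})"

text \<open>The least number exists for every graph with finitely many edges; it is 0 when there are none.\<close>

definition chromatic_index :: "'a graph \<Rightarrow> nat" where
  "chromatic_index G = (LEAST k. edge_colorable G k)"

text \<open>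
  The least number exists when \<open>G\<close> is a finite simple graph with at least one edge, since
  \<open>F = edges G\<close> is then admissible; for an edgeless graph the value is unspecified.
\<close>

definition chromatic_edge_stability_index :: "'a graph \<Rightarrow> nat" where
  "chromatic_edge_stability_index G =
     (LEAST m. \<exists>F. F \<subseteq> edges G \<and> card F = m \<and>
        chromatic_index (delete_edges G F) < chromatic_index G)"

end

theory Submission
  imports Defs
begin

text \<open>
  In an edge colouring with as few colours as possible, each colour class is a matching, and a
  matching on \<open>n\<close> vertices has at most \<open>n div 2\<close> edges. Deleting one colour class leaves
  a graph that is coloured by the remaining colours, so its chromatic index is smaller. This gives
  an admissible set of at most \<open>n div 2\<close> edges. The lower bound holds because deleting no edge
  does not change the chromatic index.
\<close>

lemma finite_edges:
  assumes "simple_graph G"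
  shows "finite (edges G)"
proof (rule finite_subset)
  show "edges G \<subseteq> Pow (verts G)"
    using assms by (auto simp: simple_graph_def)
  show "finite (Pow (verts G))"
    using assms by (simp add: simple_graph_def)
qed

lemma edge_colorable_chromatic_index:
  assumes "finite (edges G)"
  shows "edge_colorable G (chromatic_index G)"
proof -
  \<comment> \<open>Giving all edges different colours is proper, so the minimum is over a nonempty set.\<close>
  obtain c :: "'a set \<Rightarrow> nat" and k where c: "c ` edges G = {i. i < k}" "inj_on c (edges G)"
    using finite_imp_inj_to_nat_seg[OF assms] by blast
  have "proper_edge_coloring G c"
    using c(2) by (auto simp: proper_edge_coloring_def dest: inj_onD)
  then have "edge_colorable G k"
    using c(1) by (auto simp: edge_colorable_def)
  then show ?thesis
    unfolding chromatic_index_def by (rule LeastI)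
qed

lemma card_pairwise_disjoint_edges_le:
  assumes G: "simple_graph G" and M: "M \<subseteq> edges G" and disj: "pairwise disjnt M"
  shows "card M \<le> card (verts G) div 2"
proof -
  have size2: "card e = 2" if "e \<in> M" for e
    using G M that by (auto simp: simple_graph_def)
  have "card (\<Union>M) = (\<Sum>e\<in>M. card e)"
    using disj by (intro card_Union_disjoint) (auto simp: size2 intro: card_ge_0_finite)
  also have "\<dots> = card M * 2"
    by (simp add: size2)
  finally have "card (\<Union>M) = card M * 2" .
  moreover have "card (\<Union>M) \<le> card (verts G)"
    using G M by (intro card_mono) (auto simp: simple_graph_def)
  ultimately show ?thesis
    by linarith
qed

text \<open>
  The colour class to delete is the one of the largest colour: the remaining colours then form an
  initial segment of the naturals as they stand, without renaming.
\<close>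

lemma deletable_matching:
  assumes fin: "finite (edges G)" and ne: "edges G \<noteq> {}"
  obtains M where "M \<subseteq> edges G" "pairwise disjnt M"
    "chromatic_index (delete_edges G M) < chromatic_index G"
proof -
  obtain c where proper: "proper_edge_coloring G c"
    and bound: "c ` edges G \<subseteq> {..<chromatic_index G}"
    using edge_colorable_chromatic_index[OF fin] by (auto simp: edge_colorable_def)
  \<comment> \<open>An edge needs a colour, so a largest colour exists.\<close>
  obtain k where k: "chromatic_index G = Suc k"
    using bound ne by (cases "chromatic_index G") auto
  define M where "M = {e \<in> edges G. c e = k}"
  have "M \<subseteq> edges G"
    by (auto simp: M_def)
  moreover have "pairwise disjnt M"
    using proper by (auto simp: M_def pairwise_def disjnt_def proper_edge_coloring_def)
  moreover have "edge_colorable (delete_edges G M) k"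
    unfolding edge_colorable_def
  proof (intro exI conjI)
    show "proper_edge_coloring (delete_edges G M) c"
      using proper by (simp add: proper_edge_coloring_def delete_edges_def)
    show "c ` edges (delete_edges G M) \<subseteq> {..<k}"
      using bound by (force simp: delete_edges_def M_def k less_Suc_eq)
  qed
  then have "chromatic_index (delete_edges G M) \<le> k"
    unfolding chromatic_index_def by (rule Least_le)
  then have "chromatic_index (delete_edges G M) < chromatic_index G"
    by (simp add: k)
  ultimately show thesis
    by (rule that)
qed

theorem lemma1p1:
  fixes G :: "'a graph" and n :: nat
  assumes "simple_graph G"
    and "card (verts G) = n"
    and "edges G \<noteq> {}"
  shows "1 \<le> chromatic_edge_stability_index G \<and>
    chromatic_edge_stability_index G \<le> n div 2"
proof -
  let ?P = "\<lambda>m. \<exists>F. F \<subseteq> edges G \<and> card F = m \<and>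
    chromatic_index (delete_edges G F) < chromatic_index G"
  have fin: "finite (edges G)"
    using assms(1) by (rule finite_edges)
  obtain M where M: "M \<subseteq> edges G" "pairwise disjnt M"
    "chromatic_index (delete_edges G M) < chromatic_index G"
    using deletable_matching[OF fin assms(3)] .
  then have P: "?P (card M)"
    by blast
  have "chromatic_edge_stability_index G \<le> card M"
    unfolding chromatic_edge_stability_index_def using P by (rule Least_le)
  also have "\<dots> \<le> n div 2"
    using card_pairwise_disjoint_edges_le[OF assms(1) M(1,2)] assms(2) by simp
  finally have upper: "chromatic_edge_stability_index G \<le> n div 2" .
  have "?P (chromatic_edge_stability_index G)"
    unfolding chromatic_edge_stability_index_def using P by (rule LeastI)
  then obtain F where F: "F \<subseteq> edges G" "card F = chromatic_edge_stability_index G"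
    "chromatic_index (delete_edges G F) < chromatic_index G"
    by blast
  have "F \<noteq> {}"
    using F(3) by (auto simp: delete_edges_def)
  \<comment> \<open>Finiteness matters here, since an infinite set would have cardinality 0 as well.\<close>
  then have "0 < card F"
    using F(1) fin by (simp add: card_gt_0_iff finite_subset)
  with upper F(2) show ?thesis
    by simp
qed

end
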